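(* Let $N\ge2$. The spaces spanned by the two 4-dimensional vector functions of pairs $(p,q)$ of strictly positive probability mass vectors of size $N$ appearing below are isomorphic, being related, for all such $p,q$, by the linear equations $$\begin{bmatrix}\mathscr{D}(p\|q)+\mathscr{D}^c(p\|q)\\ D(p\|q)+D^c(p\|q)\\ \Delta(p\|q)+\Delta^c(p\|q)\\ C_H(p\|q)+C_J(p\|q)\end{bmatrix}=\begin{bmatrix}1&-1&1&-1\\1&-1&0&0\\1&0&0&-1\\0&-1&0&-1\end{bmatrix}\begin{bmatrix}P_p[S(X,p)]\\P_p[S(X,q)]\\P_q[S(X,q)]\\P_q[S(X,p)]\end{bmatrix},$$ with inverse transformation $$\begin{bmatrix}P_p[S(X,p)]\\P_p[S(X,q)]\\P_q[S(X,q)]\\P_q[S(X,p)]\end{bmatrix}=\begin{bmatrix}0&\tfrac12&\tfrac12&-\tfrac12\\0&-\tfrac12&\tfrac12&-\tfrac12\\1&-\tfrac12&-\tfrac12&-\tfrac12\\0&\tfrac12&-\tfrac12&-\tfrac12\end{bmatrix}\begin{bmatrix}\mathscr{D}(p\|q)+\mathscr{D}^c(p\|q)\\ D(p\|q)+D^c(p\|q)\\ \Delta(p\|q)+\Delta^c(p\|q)\\ C_H(p\|q)+C_J(p\|q)\end{bmatrix}.$$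
   Context: $X$ is a quantity with possible values $\{x_1,\dots,x_N\}$ (distinct). $E_i$ is the indicator of $X=x_i$ and $\tilde E_i=1-E_i$. For a probability mass vector $p=(p_1,\dots,p_N)$, $P_p$ denotes the prevision (expectation) when $X=x_i$ has probability $p_i$; similarly $P_q$. The total log score of a strictly positive probability mass vector $p$ is $S(X,p)=\sum_{i=1}^N E_i\log(p_i)+\sum_{i=1}^N\tilde E_i\log(1-p_i)$, with $\log$ the natural logarithm. Definitions: $D(p\|q)=\sum_i p_i\log(p_i/q_i)$; $D^c(p\|q)=\sum_i(1-p_i)\log\frac{1-p_i}{1-q_i}$; $\mathscr{D}(p\|q)=D(p\|q)+D(q\|p)$; $\mathscr{D}^c(p\|q)=D^c(p\|q)+D^c(q\|p)$; $\Delta(p\|q)=\sum_i(p_i-q_i)\log p_i$; $\Delta^c(p\|q)=\sum_i(q_i-p_i)\log(1-p_i)$; cross entropy $CH(p\|q)=-\sum_i p_i\log q_i$; cross extropy $CJ(p\|q)=-\sum_i(1-p_i)\log(1-q_i)$; $C_H(p\|q)=CH(p\|q)+CH(q\|p)$; $C_J(p\|q)=CJ(p\|q)+CJ(q\|p)$. *)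

theory Defs
  imports "HOL-Probability.Probability"
begin

text \<open>
  A probability mass vector of size N is a \<^typ>\<open>'n pmf\<close> over an index type with N elements;
  its i-th component is \<^term>\<open>pmf p i\<close>. The values of the quantity X are \<^term>\<open>x i\<close>.
\<close>

definition positive_pmfs :: "'n::finite pmf set" where
  "positive_pmfs = {p. \<forall>i. 0 < pmf p i}"

definition prevision :: "('n::finite \<Rightarrow> real) \<Rightarrow> 'n pmf \<Rightarrow> (real \<Rightarrow> real) \<Rightarrow> real" where
  "prevision x p Y = measure_pmf.expectation (map_pmf x p) Y"

text \<open>In the following definition \<^term>\<open>X\<close> is the realised value of the quantity.\<close>

definition total_log_score :: "('n::finite \<Rightarrow> real) \<Rightarrow> 'n pmf \<Rightarrow> real \<Rightarrow> real" where
  "total_log_score x p X =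
     (\<Sum>i\<in>UNIV. indicat_real {x i} X * ln (pmf p i)) +
     (\<Sum>i\<in>UNIV. (1 - indicat_real {x i} X) * ln (1 - pmf p i))"

definition div_D :: "'n::finite pmf \<Rightarrow> 'n pmf \<Rightarrow> real" where
  "div_D p q = (\<Sum>i\<in>UNIV. pmf p i * ln (pmf p i / pmf q i))"

definition div_Dc :: "'n::finite pmf \<Rightarrow> 'n pmf \<Rightarrow> real" where
  "div_Dc p q = (\<Sum>i\<in>UNIV. (1 - pmf p i) * ln ((1 - pmf p i) / (1 - pmf q i)))"

definition sym_D :: "'n::finite pmf \<Rightarrow> 'n pmf \<Rightarrow> real" where
  "sym_D p q = div_D p q + div_D q p"

definition sym_Dc :: "'n::finite pmf \<Rightarrow> 'n pmf \<Rightarrow> real" where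
  "sym_Dc p q = div_Dc p q + div_Dc q p"

definition Delta :: "'n::finite pmf \<Rightarrow> 'n pmf \<Rightarrow> real" where
  "Delta p q = (\<Sum>i\<in>UNIV. (pmf p i - pmf q i) * ln (pmf p i))"

definition Delta_c :: "'n::finite pmf \<Rightarrow> 'n pmf \<Rightarrow> real" where
  "Delta_c p q = (\<Sum>i\<in>UNIV. (pmf q i - pmf p i) * ln (1 - pmf p i))"

definition cross_entropy :: "'n::finite pmf \<Rightarrow> 'n pmf \<Rightarrow> real" where
  "cross_entropy p q = - (\<Sum>i\<in>UNIV. pmf p i * ln (pmf q i))"

definition cross_extropy :: "'n::finite pmf \<Rightarrow> 'n pmf \<Rightarrow> real" where
  "cross_extropy p q = - (\<Sum>i\<in>UNIV. (1 - pmf p i) * ln (1 - pmf q i))"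

definition sym_cross_entropy :: "'n::finite pmf \<Rightarrow> 'n pmf \<Rightarrow> real" where
  "sym_cross_entropy p q = cross_entropy p q + cross_entropy q p"

definition sym_cross_extropy :: "'n::finite pmf \<Rightarrow> 'n pmf \<Rightarrow> real" where
  "sym_cross_extropy p q = cross_extropy p q + cross_extropy q p"

definition divergence_vec :: "'n::finite pmf \<Rightarrow> 'n pmf \<Rightarrow> real^4" where
  "divergence_vec p q = vector
     [sym_D p q + sym_Dc p q,
      div_D p q + div_Dc p q,
      Delta p q + Delta_c p q,
      sym_cross_entropy p q + sym_cross_extropy p q]"

definition score_vec :: "('n::finite \<Rightarrow> real) \<Rightarrow> 'n pmf \<Rightarrow> 'n pmf \<Rightarrow> real^4" where
  "score_vec x p q = vector
     [prevision x p (total_log_score x p),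
      prevision x p (total_log_score x q),
      prevision x q (total_log_score x q),
      prevision x q (total_log_score x p)]"

definition score_to_divergence :: "real^4^4" where
  "score_to_divergence = vector
     [vector [1, -1, 1, -1],
      vector [1, -1, 0, 0],
      vector [1, 0, 0, -1],
      vector [0, -1, 0, -1]]"

definition divergence_to_score :: "real^4^4" where
  "divergence_to_score = vector
     [vector [0, 1/2, 1/2, -1/2],
      vector [0, -1/2, 1/2, -1/2],
      vector [1, -1/2, -1/2, -1/2],
      vector [0, 1/2, -1/2, -1/2]]"

end

theory Submission
  imports Defs
begin

text \<open>
  Write \<open>S p q\<close> for the prevision under \<open>p\<close> of the total log score of \<open>q\<close>. Since the values of
  \<open>X\<close> are distinct, the indicator of \<open>X = x i\<close> has prevision \<open>pmf p i\<close> (lemma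
  \<open>prevision_total_log_score\<close>), so \<open>S p q\<close> is minus the sum of the cross entropy and
  the cross extropy of \<open>p\<close> and \<open>q\<close>; the values \<open>x i\<close> drop out.
  Each component of the divergence vector is then a combination of the four scores:
  the divergences because the logarithm of a quotient is a difference of logarithms, \<open>Delta\<close> because
  \<open>q - p = (1 - p) - (1 - q)\<close>. Splitting the quotient needs \<open>0 < pmf p i < 1\<close>, and the upper
  bound is where there being at least two values is used (lemma \<open>positive_pmf_less_1\<close>).

  The two displayed matrices are mutually inverse by computation. So the first one is an injective
  linear map that carries the family of score vectors onto the family of divergence vectors, and
  therefore carries the span of the one bijectively onto the span of the other.
\<close>

lemma prevision_eq_sum: "prevision x p Y = (\<Sum>j\<in>UNIV. pmf p j * Y (x j))"
  unfolding prevision_def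
  by (simp add: integral_measure_pmf[where A = UNIV])

text \<open>
  Injectivity of \<open>x\<close> makes the event \<open>X = x i\<close> have probability \<open>pmf p i\<close> and nothing more;
  otherwise the indices sharing the value \<open>x i\<close> would all contribute to it.
\<close>
lemma prevision_total_log_score:
  fixes x :: "'n::finite \<Rightarrow> real"
  assumes "inj x"
  shows "prevision x p (total_log_score x q) = - (cross_entropy p q + cross_extropy p q)"
proof -
  have ind: "indicat_real {x i} (x j) = of_bool (i = j)" for i j
    using assms by (auto simp: indicator_def inj_def)
  have total: "(\<Sum>j\<in>UNIV. pmf p j) = 1"
    by (simp add: sum_pmf_eq_1)
  have at: "(\<Sum>j\<in>UNIV. pmf p j * (of_bool (i = j) * c)) = pmf p i * c" for i c
  proof -
    have "(\<Sum>j\<in>UNIV. pmf p j * (of_bool (i = j) * c)) =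
        (\<Sum>j\<in>UNIV. if i = j then pmf p i * c else 0)"
      by (intro sum.cong) auto
    then show ?thesis
      by simp
  qed
  have off: "(\<Sum>j\<in>UNIV. pmf p j * ((1 - of_bool (i = j)) * c)) = (1 - pmf p i) * c" for i c
  proof -
    have "(\<Sum>j\<in>UNIV. pmf p j * ((1 - of_bool (i = j)) * c)) =
        (\<Sum>j\<in>UNIV. pmf p j * c - (if i = j then pmf p i * c else 0))"
      by (intro sum.cong) auto
    also have "\<dots> = (1 - pmf p i) * c"
      by (simp add: sum_subtractf left_diff_distrib total flip: sum_distrib_right)
    finally show ?thesis .
  qed
  have "prevision x p (total_log_score x q) =
    (\<Sum>i\<in>UNIV. \<Sum>j\<in>UNIV. pmf p j * (of_bool (i = j) * ln (pmf q i))) +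
    (\<Sum>i\<in>UNIV. \<Sum>j\<in>UNIV. pmf p j * ((1 - of_bool (i = j)) * ln (1 - pmf q i)))"
    unfolding prevision_eq_sum total_log_score_def ind
    by (simp only: distrib_left sum.distrib sum_distrib_left)
       (intro arg_cong2[where f = "(+)"] sum.swap)
  then show ?thesis
    by (simp add: at off cross_entropy_def cross_extropy_def)
qed

text \<open>
  A second index carries positive mass as well, which leaves less than the whole for the first.
  This keeps every \<open>1 - pmf p i\<close> in the range where the logarithm of a quotient splits.
\<close>
lemma positive_pmf_less_1:
  fixes p :: "'n::finite pmf"
  assumes "CARD('n) \<ge> 2" and "p \<in> positive_pmfs"
  shows "pmf p i < 1"
proof -
  obtain j where "j \<noteq> i"
  proof -
    have "UNIV \<noteq> {i}"
    proof
      assume "UNIV = {i}"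
      then have "CARD('n) = card {i}"
        by simp
      with assms(1) show False
        by simp
    qed
    then show ?thesis
      using that by blast
  qed
  have "pmf p i + pmf p j = (\<Sum>k\<in>{i, j}. pmf p k)"
    using \<open>j \<noteq> i\<close> by simp
  also have "\<dots> \<le> (\<Sum>k\<in>UNIV. pmf p k)"
    by (intro sum_mono2) auto
  also have "\<dots> = 1"
    by (simp add: sum_pmf_eq_1)
  finally show ?thesis
    using assms(2) by (simp add: positive_pmfs_def) (smt (verit))
qed

lemma div_D_eq_cross_entropy:
  assumes "p \<in> positive_pmfs" and "q \<in> positive_pmfs"
  shows "div_D p q = cross_entropy p q - cross_entropy p p"
proof -
  have "pmf p i * ln (pmf p i / pmf q i) = pmf p i * ln (pmf p i) - pmf p i * ln (pmf q i)" for i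
  proof -
    have "0 < pmf p i" "0 < pmf q i"
      using assms by (auto simp: positive_pmfs_def)
    then show ?thesis
      by (simp add: ln_divide_pos right_diff_distrib)
  qed
  then show ?thesis
    by (simp add: div_D_def cross_entropy_def sum_subtractf)
qed

lemma div_Dc_eq_cross_extropy:
  fixes p q :: "'n::finite pmf"
  assumes "CARD('n) \<ge> 2" and "p \<in> positive_pmfs" and "q \<in> positive_pmfs"
  shows "div_Dc p q = cross_extropy p q - cross_extropy p p"
proof -
  have "(1 - pmf p i) * ln ((1 - pmf p i) / (1 - pmf q i)) =
      (1 - pmf p i) * ln (1 - pmf p i) - (1 - pmf p i) * ln (1 - pmf q i)" for i
    using assms positive_pmf_less_1[of p i] positive_pmf_less_1[of q i]
    by (simp add: ln_divide_pos right_diff_distrib)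
  then show ?thesis
    by (simp add: div_Dc_def cross_extropy_def sum_subtractf)
qed

lemma Delta_eq_cross_entropy: "Delta p q = cross_entropy q p - cross_entropy p p"
  by (simp add: Delta_def cross_entropy_def left_diff_distrib sum_subtractf)

lemma Delta_c_eq_cross_extropy: "Delta_c p q = cross_extropy q p - cross_extropy p p"
  by (simp add: Delta_c_def cross_extropy_def left_diff_distrib sum_subtractf)

lemma vector_4_nth:
  "(vector [a, b, c, d] :: 'a::zero^4) $ 1 = a"
  "(vector [a, b, c, d] :: 'a::zero^4) $ 2 = b"
  "(vector [a, b, c, d] :: 'a::zero^4) $ 3 = c"
  "(vector [a, b, c, d] :: 'a::zero^4) $ 4 = d"
  by (simp_all add: vector_def)

lemma divergence_to_score_times_score_to_divergence:
  "divergence_to_score ** score_to_divergence = mat 1"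
  by (simp add: vec_eq_iff forall_4 matrix_matrix_mult_def sum_4 mat_def vector_4_nth
      divergence_to_score_def score_to_divergence_def)

lemma score_to_divergence_times_divergence_to_score:
  "score_to_divergence ** divergence_to_score = mat 1"
  by (simp add: matrix_left_right_inverse divergence_to_score_times_score_to_divergence)

lemma divergence_vec_eq_score_vec:
  fixes x :: "'n::finite \<Rightarrow> real"
  assumes "CARD('n) \<ge> 2" and "inj x" and "p \<in> positive_pmfs" and "q \<in> positive_pmfs"
  shows "divergence_vec p q = score_to_divergence *v score_vec x p q"
  using assms
  by (simp add: vec_eq_iff forall_4 matrix_vector_mult_def sum_4 vector_4_nth
      divergence_vec_def score_vec_def score_to_divergence_def
      prevision_total_log_score sym_D_def sym_Dc_def div_D_eq_cross_entropy
      div_Dc_eq_cross_extropy Delta_eq_cross_entropy Delta_c_eq_cross_extropy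
      sym_cross_entropy_def sym_cross_extropy_def)

lemma bij_betw_span_image:
  assumes "linear f" and "inj f"
  shows "bij_betw f (span S) (span (f ` S))"
  using assms by (auto simp: bij_betw_def linear_span_image intro: inj_on_subset)

theorem mainTheorem10:
  fixes x :: "'n::finite \<Rightarrow> real"
  assumes "CARD('n) \<ge> 2" and "inj x"
  shows "(\<forall>p\<in>positive_pmfs. \<forall>q\<in>positive_pmfs.
            divergence_vec p q = score_to_divergence *v score_vec x p q \<and>
            score_vec x p q = divergence_to_score *v divergence_vec p q) \<and>
         divergence_to_score ** score_to_divergence = mat 1 \<and>
         score_to_divergence ** divergence_to_score = mat 1 \<and>
         linear ((*v) score_to_divergence) \<and>
         bij_betw ((*v) score_to_divergence)
           (span {score_vec x p q | p q. p \<in> positive_pmfs \<and> q \<in> positive_pmfs})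
           (span {divergence_vec p q | p q :: 'n pmf. p \<in> positive_pmfs \<and> q \<in> positive_pmfs})"
proof -
  note inverses = divergence_to_score_times_score_to_divergence
    score_to_divergence_times_divergence_to_score
  have forward: "divergence_vec p q = score_to_divergence *v score_vec x p q"
    if "p \<in> positive_pmfs" "q \<in> positive_pmfs" for p q
    using divergence_vec_eq_score_vec assms that .
  have backward: "score_vec x p q = divergence_to_score *v divergence_vec p q"
    if "p \<in> positive_pmfs" "q \<in> positive_pmfs" for p q
    using forward[OF that] inverses(1) by (simp add: matrix_vector_mul_assoc)
  have linear: "linear ((*v) score_to_divergence)"
    by (rule matrix_vector_mul_linear)
  have inj: "inj ((*v) score_to_divergence)"
    using inverses(1) matrix_left_invertible_injective by blast
  have image: "{divergence_vec p q | p q :: 'n pmf. p \<in> positive_pmfs \<and> q \<in> positive_pmfs} =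
      (*v) score_to_divergence `
        {score_vec x p q | p q. p \<in> positive_pmfs \<and> q \<in> positive_pmfs}"
    using forward by (force simp: image_def)
  show ?thesis
    unfolding image
    using forward backward inverses linear bij_betw_span_image[OF linear inj] by blast
qed

end
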